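(* Let $r\ge 1$. Let $X$ and $Y$ be connected $C^r$-manifolds (possibly with boundary) of equal dimensions, with $X$ compact. Let $f\colon X\to Y$ be a $C^r$-mapping whose differential $\mathrm{d}f$ is nondegenerate on $X$ (that is, $\operatorname{rank}(\mathrm{d}f)=\dim X$ at every point of $X$), and such that $f(\partial X)\subseteq\partial Y$. Suppose that there exists a point $y\in Y$ whose preimage $f^{-1}(y)$ consists of exactly one point. Then $f$ is a $C^r$-diffeomorphism of $X$ onto $Y$.
   Context: An $n$-dimensional topological manifold is a Hausdorff space having a countable cover by open sets each homeomorphic either to $\mathbb{R}^n$ or to $\mathbb{R}^n_+=\{(x_1,\ldots,x_n): x_i\in\mathbb{R},\ x_1\ge 0\}$; its boundary $\partial X$ is the set of points having no neighborhood homeomorphic to $\mathbb{R}^n$ (it may be empty). A chart is a homeomorphism of an open domain $U\subset X$ to $\mathbb{R}^n$ or $\mathbb{R}^n_+$; a $C^r$-structure is a cover of $X$ by charts whose transition maps and their inverses are pairwise $C^r$-smooth, two structures being equivalent if their union is also a $C^r$-structure. A $C^r$-manifold is a topological manifold with an equivalence class of $C^r$-structures. A $C^r$-mapping is a continuous mapping that is $C^r$-smooth in charts. A $C^r$-diffeomorphism is a bijective $C^r$-mapping whose inverse is also a $C^r$-mapping. *)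

theory Defs
  imports "HOL-Analysis.Analysis" "HOL-Library.Extended_Nat"
begin

section \<open>\<open>C\<^sup>r\<close>-maps between subsets of \<open>\<real>\<^sup>n\<close>\<close>

text \<open>For \<open>W\<close> open in a finite-dimensional space this is the usual notion: all partial derivatives
  up to order \<open>k\<close> exist and are continuous on \<open>W\<close>.\<close>

primrec Ck_on_open ::
  "nat \<Rightarrow> 'e::real_normed_vector set \<Rightarrow> ('e \<Rightarrow> 'f::real_normed_vector) \<Rightarrow> bool"
where
  "Ck_on_open 0 W g \<longleftrightarrow> continuous_on W g"
| "Ck_on_open (Suc k) W g \<longleftrightarrow>
     (\<forall>p\<in>W. g differentiable (at p)) \<and>
     (\<forall>v. Ck_on_open k W (\<lambda>p. frechet_derivative g (at p) v))"

text \<open>Smoothness on a set that need not be open (e.g. relatively open in a half-space) means, as usual,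
  that the map extends near each point to a \<open>C\<^sup>r\<close>-map on an open set.
  The case \<open>r = \<infinity>\<close> is included.\<close>

definition Cr_on ::
  "enat \<Rightarrow> 'e::real_normed_vector set \<Rightarrow> ('e \<Rightarrow> 'f::real_normed_vector) \<Rightarrow> bool"
where
  "Cr_on r S g \<longleftrightarrow>
     (\<forall>p\<in>S. \<exists>W G. open W \<and> p \<in> W \<and> (\<forall>q\<in>S \<inter> W. G q = g q) \<and>
        (\<forall>k. enat k \<le> r \<longrightarrow> Ck_on_open k W G))"


section \<open>Topological manifolds with boundary\<close>

text \<open>The least element of the index type plays the role of the index \<open>1\<close>.\<close>

definition half_space :: "(real ^ 'n::{finite,linorder}) set" where
  "half_space = {x. 0 \<le> x $ Min UNIV}"

text \<open>The dimension is \<open>CARD('n)\<close>; it is passed as a type argument since \<open>'n\<close> does not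
  occur in the type of the space.\<close>

definition topological_manifold :: "'n::{finite,linorder} itself \<Rightarrow> 'a topology \<Rightarrow> bool" where
  "topological_manifold (_ :: 'n itself) X \<longleftrightarrow>
     Hausdorff_space X \<and>
     (\<exists>\<U>. countable \<U> \<and> \<Union>\<U> = topspace X \<and>
        (\<forall>U\<in>\<U>. openin X U \<and>
           (subtopology X U homeomorphic_space (euclidean :: (real, 'n) vec topology) \<or>
            subtopology X U homeomorphic_space top_of_set (half_space :: (real, 'n) vec set))))"

definition manifold_boundary :: "'n::{finite,linorder} itself \<Rightarrow> 'a topology \<Rightarrow> 'a set" where
  "manifold_boundary (_ :: 'n itself) X =
     {x \<in> topspace X.
        \<not> (\<exists>U. openin X U \<and> x \<in> U \<and>
              subtopology X U homeomorphic_space (euclidean :: (real, 'n) vec topology))}"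


section \<open>\<open>C\<^sup>r\<close>-structures and \<open>C\<^sup>r\<close>-manifolds\<close>

text \<open>A chart is given by its domain and a map of which only the values on the domain matter.\<close>

type_synonym ('a, 'n) chart = "'a set \<times> ('a \<Rightarrow> real ^ 'n)"

definition is_chart :: "'a topology \<Rightarrow> ('a, 'n::{finite,linorder}) chart \<Rightarrow> bool" where
  "is_chart X c \<longleftrightarrow>
     (case c of (U, \<phi>) \<Rightarrow>
        openin X U \<and>
        (homeomorphic_map (subtopology X U) euclidean \<phi> \<or>
         homeomorphic_map (subtopology X U) (top_of_set half_space) \<phi>))"

text \<open>Both transition maps between two charts are covered, as \<open>c\<close> and \<open>d\<close> range over all ordered
  pairs.\<close>

definition Cr_structure ::
  "enat \<Rightarrow> 'a topology \<Rightarrow> ('a, 'n::{finite,linorder}) chart set \<Rightarrow> bool"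
where
  "Cr_structure r X A \<longleftrightarrow>
     (\<forall>c\<in>A. is_chart X c) \<and> \<Union>(fst ` A) = topspace X \<and>
     (\<forall>c\<in>A. \<forall>d\<in>A.
        case (c, d) of ((U, \<phi>), (V, \<psi>)) \<Rightarrow>
          Cr_on r (\<phi> ` (U \<inter> V)) (\<psi> \<circ> inv_into U \<phi>))"

definition Cr_structure_equiv ::
  "enat \<Rightarrow> 'a topology \<Rightarrow>
     (('a, 'n::{finite,linorder}) chart set \<times> ('a, 'n) chart set) set"
where
  "Cr_structure_equiv r X =
     {(A, B). Cr_structure r X A \<and> Cr_structure r X B \<and> Cr_structure r X (A \<union> B)}"

definition Cr_manifold ::
  "enat \<Rightarrow> 'a topology \<Rightarrow> ('a, 'n::{finite,linorder}) chart set set \<Rightarrow> bool"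
where
  "Cr_manifold r X \<A> \<longleftrightarrow>
     topological_manifold TYPE('n) X \<and>
     \<A> \<in> {A. Cr_structure r X A} // Cr_structure_equiv r X"


section \<open>\<open>C\<^sup>r\<close>-mappings\<close>

text \<open>The charts of a manifold are the members of the structures in its equivalence class \<open>\<A>\<close>,
  that is, the elements of \<open>\<Union>\<A>\<close>.

  \<open>local_dom\<close> and \<open>local_rep\<close> describe \<open>\<psi> \<circ> f \<circ> \<phi>\<^sup>-\<^sup>1 : \<phi> (U \<inter> f\<^sup>-\<^sup>1 V) \<rightarrow> \<psi> V\<close>.\<close>

definition local_dom ::
  "('a \<Rightarrow> 'b) \<Rightarrow> ('a, 'n) chart \<Rightarrow> ('b, 'n) chart \<Rightarrow> (real ^ 'n::{finite,linorder}) set"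
where
  "local_dom f c d = snd c ` (fst c \<inter> f -` fst d)"

definition local_rep ::
  "('a \<Rightarrow> 'b) \<Rightarrow> ('a, 'n) chart \<Rightarrow> ('b, 'n) chart \<Rightarrow>
     real ^ 'n::{finite,linorder} \<Rightarrow> (real, 'n) vec"
where
  "local_rep f c d = snd d \<circ> f \<circ> inv_into (fst c) (snd c)"

definition Cr_mapping ::
  "enat \<Rightarrow> 'a topology \<Rightarrow> ('a, 'n::{finite,linorder}) chart set set \<Rightarrow>
     'b topology \<Rightarrow> ('b, 'n) chart set set \<Rightarrow> ('a \<Rightarrow> 'b) \<Rightarrow> bool"
where
  "Cr_mapping r X \<A> Y \<B> f \<longleftrightarrow>
     continuous_map X Y f \<and>
     (\<forall>c\<in>\<Union>\<A>. \<forall>d\<in>\<Union>\<B>. Cr_on r (local_dom f c d) (local_rep f c d))"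

text \<open>The derivative is taken within \<open>local_dom f c d\<close>, which is relatively open in \<open>\<real>\<^sup>n\<close> or in
  the half-space; hence it is unique, also at boundary points.\<close>

definition differential_rank_in_charts ::
  "('a \<Rightarrow> 'b) \<Rightarrow> ('a, 'n::{finite,linorder}) chart \<Rightarrow> ('b, 'n) chart \<Rightarrow> 'a \<Rightarrow> nat"
where
  "differential_rank_in_charts f c d x =
     rank (matrix (frechet_derivative (local_rep f c d) (at (snd c x) within local_dom f c d)))"

text \<open>The rank does not depend on the charts, so it is required to be full in all of them.\<close>

definition nondegenerate_differential ::
  "'a topology \<Rightarrow> ('a, 'n::{finite,linorder}) chart set set \<Rightarrow>
     ('b, 'n) chart set set \<Rightarrow> ('a \<Rightarrow> 'b) \<Rightarrow> bool"
where
  "nondegenerate_differential X \<A> \<B> f \<longleftrightarrow>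
     (\<forall>x\<in>topspace X. \<forall>c\<in>\<Union>\<A>. \<forall>d\<in>\<Union>\<B>. x \<in> fst c \<longrightarrow> f x \<in> fst d \<longrightarrow>
        differential_rank_in_charts f c d x = CARD('n))"

definition Cr_diffeomorphism ::
  "enat \<Rightarrow> 'a topology \<Rightarrow> ('a, 'n::{finite,linorder}) chart set set \<Rightarrow>
     'b topology \<Rightarrow> ('b, 'n) chart set set \<Rightarrow> ('a \<Rightarrow> 'b) \<Rightarrow> bool"
where
  "Cr_diffeomorphism r X \<A> Y \<B> f \<longleftrightarrow>
     Cr_mapping r X \<A> Y \<B> f \<and> bij_betw f (topspace X) (topspace Y) \<and>
     Cr_mapping r Y \<B> X \<A> (inv_into (topspace X) f)"

end

theory Submission
  imports Defs
begin

text \<open>The heart of the proof is that \<open>f\<close> is an open map and locally injective. Given that, the rest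
  is point-set topology. The image of \<open>f\<close> is open, and closed because \<open>X\<close> is compact, so \<open>f\<close> is
  onto the connected space \<open>Y\<close>. The set of points of \<open>Y\<close> with a one-point fibre is open (compactness
  keeps other sheets away from such a fibre) and its complement is open (two preimages persist, since
  \<open>f\<close> is open). It is nonempty by assumption, hence it is all of \<open>Y\<close> and \<open>f\<close> is bijective
  (\<open>locally_injective_unique_fibre_imp_bij\<close>).

  Local injectivity comes from the inverse function theorem, applied to an extension \<open>G\<close> of a local
  representation of \<open>f\<close> to an open subset of \<open>\<real>\<^sup>n\<close>. The differential of the local representation
  determines that of \<open>G\<close>, even at a boundary point (\<open>has_derivative_within_model_unique\<close>). The same
  theorem in its \<open>C\<^sup>k\<close> form (\<open>Ck_inverse_function_theorem\<close>), with one neighbourhood serving all \<open>k\<close>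
  at once, provides the smooth extensions which show that \<open>f\<^sup>-\<^sup>1\<close> is a \<open>C\<^sup>r\<close>-mapping. Once a bijective
  \<open>f\<close> is known to be open, \<open>f\<^sup>-\<^sup>1\<close> is continuous and coincides with the local inverse of \<open>G\<close> near
  each point.

  Openness is delicate only at the boundary: \<open>G\<close> is open as a map of \<open>\<real>\<^sup>n\<close>, but the part of
  the domain inside the half-space has to fill a neighbourhood of the image point \<^emph>\<open>within the half-space\<close>. This
  is where \<open>f(\<partial>X) \<subseteq> \<partial>Y\<close> enters. On a small ball \<open>B\<close> around the image point,
  the connected set \<open>B \<inter> interior T\<close> (\<open>T\<close> being the target model space) cannot meet the image of
  the frontier of the source model, so it lies entirely in the image of the interior or entirely in the image
  of the exterior, and it meets the former (\<open>homeomorphism_image_neighbourhood\<close>). The boundary condition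
  is stated for the topological boundary; invariance of domain translates it into frontiers of model
  spaces (\<open>manifold_boundary_iff_frontier\<close>).

  Treating \<open>\<real>\<^sup>n\<close> as a model space with empty frontier makes a distinction between interior and boundary
  points unnecessary.\<close>

section \<open>Calculus of \<open>C\<^sup>k\<close>-maps\<close>

text \<open>The definition uses derivatives in the ambient space, so agreement on \<open>W\<close> is enough only because
  \<open>W\<close> is open.\<close>

lemma Ck_on_open_cong:
  assumes "open W" "\<And>p. p \<in> W \<Longrightarrow> f p = g p" "Ck_on_open k W f"
  shows "Ck_on_open k W g"
  using assms(2,3)
proof (induction k arbitrary: f g)
  case 0
  then show ?case by (simp cong: continuous_on_cong)
next
  case (Suc k)
  have D: "(g has_derivative frechet_derivative f (at p)) (at p)" if p: "p \<in> W" for p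
    using has_derivative_transform_within_open[OF _ \<open>open W\<close> p Suc.prems(1)] Suc.prems(2) p
    by (simp add: frechet_derivative_works)
  have eq: "frechet_derivative f (at p) = frechet_derivative g (at p)" if p: "p \<in> W" for p
    using frechet_derivative_at[OF D[OF p]] .
  show ?case
    using Suc.prems(2) Suc.IH[of "\<lambda>p. frechet_derivative f (at p) v" "\<lambda>p. frechet_derivative g (at p) v" for v]
      D eq by (auto simp: differentiable_def)
qed

lemma Ck_on_open_subset: "Ck_on_open k W f \<Longrightarrow> W' \<subseteq> W \<Longrightarrow> Ck_on_open k W' f"
  by (induction k arbitrary: f) (auto intro: continuous_on_subset)

text \<open>Since Frechet derivatives are unique, any explicit formula for the derivative may replace the one chosen
  by \<open>frechet_derivative\<close>. The closure properties below go through this rule, by induction on \<open>k\<close>.\<close>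

lemma Ck_on_open_SucI:
  assumes "open W" "\<And>p. p \<in> W \<Longrightarrow> (f has_derivative D p) (at p)"
    "\<And>v. Ck_on_open k W (\<lambda>p. D p v)"
  shows "Ck_on_open (Suc k) W f"
proof -
  have "D p = frechet_derivative f (at p)" if "p \<in> W" for p
    using frechet_derivative_at assms(2) that by blast
  then have "Ck_on_open k W (\<lambda>p. frechet_derivative f (at p) v)" for v
    using Ck_on_open_cong[OF assms(1) _ assms(3)[of v]] by simp
  then show ?thesis
    using assms(2) by (auto simp: differentiable_def)
qed

lemma Ck_on_open_Suc_deriv:
  assumes "Ck_on_open (Suc k) W f" "p \<in> W"
  shows "(f has_derivative frechet_derivative f (at p)) (at p)"
  using assms by (simp add: frechet_derivative_works)

lemma Ck_on_open_SucD: "Ck_on_open (Suc k) W f \<Longrightarrow> Ck_on_open k W f"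
proof (induction k arbitrary: f)
  case 0
  then show ?case
    by (auto intro!: continuous_at_imp_continuous_on differentiable_imp_continuous_within)
next
  case (Suc k)
  then show ?case by (metis Ck_on_open.simps(2))
qed

lemma Ck_on_open_const: "open W \<Longrightarrow> Ck_on_open k W (\<lambda>p. c)"
proof (induction k arbitrary: c)
  case (Suc k)
  show ?case
    by (rule Ck_on_open_SucI[where D="\<lambda>p v. 0"]) (use Suc in auto)
qed simp

lemma Ck_on_open_add:
  "open W \<Longrightarrow> Ck_on_open k W f \<Longrightarrow> Ck_on_open k W g \<Longrightarrow> Ck_on_open k W (\<lambda>p. f p + g p)"
proof (induction k arbitrary: f g)
  case (Suc k)
  show ?case
    by (rule Ck_on_open_SucI[where D="\<lambda>p v. frechet_derivative f (at p) v + frechet_derivative g (at p) v"])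
      (use Suc in \<open>auto intro!: has_derivative_add simp flip: frechet_derivative_works\<close>)
qed (auto intro: continuous_intros)

lemma Ck_on_open_sum:
  assumes "open W" "finite I" "\<And>i. i \<in> I \<Longrightarrow> Ck_on_open k W (f i)"
  shows "Ck_on_open k W (\<lambda>p. \<Sum>i\<in>I. f i p)"
  using assms(2,3)
  by (induction I) (simp_all add: Ck_on_open_const Ck_on_open_add assms(1))

lemma Ck_on_open_bounded_linear:
  assumes "open W" "bounded_linear L"
  shows "Ck_on_open k W f \<Longrightarrow> Ck_on_open k W (\<lambda>p. L (f p))"
proof (induction k arbitrary: f)
  case 0
  then show ?case by (simp add: bounded_linear.continuous_on assms)
next
  case (Suc k)
  show ?case
  proof (rule Ck_on_open_SucI[where D="\<lambda>p v. L (frechet_derivative f (at p) v)"])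
    show "((\<lambda>p. L (f p)) has_derivative (\<lambda>v. L (frechet_derivative f (at p) v))) (at p)" if "p \<in> W" for p
      using bounded_linear.has_derivative[OF assms(2) Ck_on_open_Suc_deriv[OF Suc.prems that]] .
  qed (use assms Suc in auto)
qed

text \<open>The product rule expresses the derivative through bilinear terms one degree lower.\<close>

lemma Ck_on_open_bilinear:
  assumes "open W" "bounded_bilinear B"
  shows "Ck_on_open k W f \<Longrightarrow> Ck_on_open k W g \<Longrightarrow> Ck_on_open k W (\<lambda>p. B (f p) (g p))"
proof (induction k arbitrary: f g)
  case 0
  then show ?case by (simp add: bounded_bilinear.continuous_on assms)
next
  case (Suc k)
  show ?case
  proof (rule Ck_on_open_SucI[where D="\<lambda>p v. B (f p) (frechet_derivative g (at p) v) + B (frechet_derivative f (at p) v) (g p)"])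
    show "((\<lambda>p. B (f p) (g p)) has_derivative (\<lambda>v. B (f p) (frechet_derivative g (at p) v) + B (frechet_derivative f (at p) v) (g p))) (at p)"
      if "p \<in> W" for p
      using bounded_bilinear.FDERIV[OF assms(2) Ck_on_open_Suc_deriv[OF Suc.prems(1) that]
          Ck_on_open_Suc_deriv[OF Suc.prems(2) that]] .
    show "Ck_on_open k W (\<lambda>p. B (f p) (frechet_derivative g (at p) v) + B (frechet_derivative f (at p) v) (g p))" for v
      using Suc Ck_on_open_SucD[OF Suc.prems(1)] Ck_on_open_SucD[OF Suc.prems(2)]
      by (intro Ck_on_open_add) (auto simp: assms)
  qed (rule assms)
qed

lemma Ck_on_open_prod:
  fixes f :: "'i \<Rightarrow> 'e::real_normed_vector \<Rightarrow> real"
  assumes "open W" "finite I" "\<And>i. i \<in> I \<Longrightarrow> Ck_on_open k W (f i)"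
  shows "Ck_on_open k W (\<lambda>p. \<Prod>i\<in>I. f i p)"
  using assms(2,3)
  by (induction I)
    (simp_all add: Ck_on_open_const Ck_on_open_bilinear[OF _ bounded_bilinear_mult] assms(1))

text \<open>The derivative of \<open>1/f\<close> is a polynomial in \<open>1/f\<close> and the derivative of \<open>f\<close>, so the
  induction feeds on itself.\<close>

lemma Ck_on_open_inverse:
  fixes f :: "'e::real_normed_vector \<Rightarrow> real"
  assumes "open W" "\<And>p. p \<in> W \<Longrightarrow> f p \<noteq> 0"
  shows "Ck_on_open k W f \<Longrightarrow> Ck_on_open k W (\<lambda>p. inverse (f p))"
proof (induction k)
  case 0
  then show ?case using assms by (simp add: continuous_on_inverse)
next
  case (Suc k)
  note IH = Suc.IH[OF Ck_on_open_SucD[OF Suc.prems]]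
  show ?case
  proof (rule Ck_on_open_SucI[where D="\<lambda>p v. - (inverse (f p) * frechet_derivative f (at p) v * inverse (f p))"])
    show "((\<lambda>p. inverse (f p)) has_derivative (\<lambda>v. - (inverse (f p) * frechet_derivative f (at p) v * inverse (f p)))) (at p)"
      if "p \<in> W" for p
      using Deriv.has_derivative_inverse[OF assms(2)[OF that] Ck_on_open_Suc_deriv[OF Suc.prems that]] .
    show "Ck_on_open k W (\<lambda>p. - (inverse (f p) * frechet_derivative f (at p) v * inverse (f p)))" for v
      using IH Suc.prems assms(1)
      by (intro Ck_on_open_bounded_linear[where L=uminus] Ck_on_open_bilinear[OF _ bounded_bilinear_mult])
        (auto intro: bounded_linear_minus bounded_linear_ident)
  qed (rule assms)
qed

lemma Ck_on_open_vec_lambda: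
  fixes f :: "'n::finite \<Rightarrow> 'e::real_normed_vector \<Rightarrow> real"
  assumes "open W" "\<And>i. Ck_on_open k W (f i)"
  shows "Ck_on_open k W (\<lambda>p. \<chi> i. f i p)"
proof -
  have "(\<lambda>p. \<chi> i. f i p) = (\<lambda>p. \<Sum>i\<in>UNIV. f i p *\<^sub>R axis i 1)"
    using basis_expansion[of "\<chi> i. f i p" for p] by (simp add: scalar_mult_eq_scaleR)
  then show ?thesis
    using assms
    by (simp only:) (intro Ck_on_open_sum finite Ck_on_open_bilinear[OF _ bounded_bilinear_scaleR]
        Ck_on_open_const; simp)
qed

text \<open>By the chain rule, \<open>D(g \<circ> h) v = Dg(h) (Dh v)\<close>. Expanding \<open>Dh v\<close> in a basis turns this into a sum
  of scalar multiples of the maps \<open>Dg(h) b\<close> with \<open>b\<close> fixed, and these are compositions of lower degree.\<close>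

lemma Ck_on_open_compose:
  fixes g :: "'e::euclidean_space \<Rightarrow> 'f::real_normed_vector"
  assumes "open V" "open W"
  shows "Ck_on_open k V h \<Longrightarrow> h ` V \<subseteq> W \<Longrightarrow> Ck_on_open k W g \<Longrightarrow> Ck_on_open k V (\<lambda>q. g (h q))"
proof (induction k arbitrary: g)
  case 0
  then show ?case using continuous_on_compose2[of W g V h] by simp
next
  case (Suc k)
  let ?dg = "\<lambda>p. frechet_derivative g (at p)" and ?dh = "\<lambda>q. frechet_derivative h (at q)"
  show ?case
  proof (rule Ck_on_open_SucI[where D="\<lambda>q v. \<Sum>b\<in>Basis. (?dh q v \<bullet> b) *\<^sub>R ?dg (h q) b"])
    fix q assume q: "q \<in> V"
    then have "h q \<in> W" using Suc.prems by auto
    note dg = Ck_on_open_Suc_deriv[OF Suc.prems(3) this]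
      and dh = Ck_on_open_Suc_deriv[OF Suc.prems(1) q]
    have "?dg (h q) (?dh q v) = (\<Sum>b\<in>Basis. (?dh q v \<bullet> b) *\<^sub>R ?dg (h q) b)" for v
    proof -
      have lin: "linear (?dg (h q))"
        using dg has_derivative_linear by blast
      have "?dg (h q) (?dh q v) = ?dg (h q) (\<Sum>b\<in>Basis. (?dh q v \<bullet> b) *\<^sub>R b)"
        by (simp add: euclidean_representation)
      then show ?thesis
        by (simp add: linear_sum[OF lin] linear_scale[OF lin])
    qed
    then show "((\<lambda>q. g (h q)) has_derivative (\<lambda>v. \<Sum>b\<in>Basis. (?dh q v \<bullet> b) *\<^sub>R ?dg (h q) b)) (at q)"
      using diff_chain_at[OF dh dg] by (simp add: o_def)
  next
    fix v
    show "Ck_on_open k V (\<lambda>q. \<Sum>b\<in>Basis. (?dh q v \<bullet> b) *\<^sub>R ?dg (h q) b)"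
    proof (intro Ck_on_open_sum Ck_on_open_bilinear[OF _ bounded_bilinear_scaleR] assms finite_Basis)
      fix b :: 'e
      show "Ck_on_open k V (\<lambda>q. ?dh q v \<bullet> b)"
        using Suc.prems(1) by (simp add: Ck_on_open_bounded_linear[OF assms(1) bounded_linear_inner_left])
      show "Ck_on_open k V (\<lambda>q. ?dg (h q) b)"
        using Suc.IH[OF Ck_on_open_SucD[OF Suc.prems(1)] Suc.prems(2), of "\<lambda>p. ?dg p b"] Suc.prems(3)
        by simp
    qed
  qed (rule assms)
qed

section \<open>The inverse function theorem for \<open>C\<^sup>k\<close>-maps\<close>

lemma Ck_on_open_det:
  fixes A :: "'e::real_normed_vector \<Rightarrow> real ^ 'n ^ 'n"
  assumes "open W" "\<And>i j. Ck_on_open k W (\<lambda>p. A p $ i $ j)"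
  shows "Ck_on_open k W (\<lambda>p. det (A p))"
  unfolding det_def
  by (intro Ck_on_open_sum Ck_on_open_prod Ck_on_open_bilinear[OF _ bounded_bilinear_mult]
      Ck_on_open_const assms finite_permutations finite)

text \<open>Cramer's rule writes the entries of the inverse as quotients of determinants, hence as rational
  functions of the entries.\<close>

lemma Ck_on_open_inverse_linear:
  fixes D :: "'e::real_normed_vector \<Rightarrow> real ^ 'n \<Rightarrow> real ^ 'n"
  assumes "open W" "\<And>p. p \<in> W \<Longrightarrow> linear (D p)" "\<And>p. p \<in> W \<Longrightarrow> bij (D p)"
    "\<And>v. Ck_on_open k W (\<lambda>p. D p v)"
  shows "Ck_on_open k W (\<lambda>p. inv (D p) v)"
proof -
  let ?N = "\<lambda>p m. (\<chi> i j. if j = m then v $ i else matrix (D p) $ i $ j)"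
  let ?x = "\<lambda>p. \<chi> m. det (?N p m) * inverse (det (matrix (D p)))"
  have entries: "Ck_on_open k W (\<lambda>p. matrix (D p) $ i $ j)" for i j
    unfolding matrix_def using assms(1,4)
    by (simp add: Ck_on_open_bounded_linear[OF _ bounded_linear_vec_nth])
  have det_nz: "det (matrix (D p)) \<noteq> 0" if "p \<in> W" for p
    using that assms(2,3)[of p] by (meson bij_def det_nz_iff_inj)
  have smooth: "Ck_on_open k W ?x"
  proof (intro Ck_on_open_vec_lambda Ck_on_open_bilinear[OF _ bounded_bilinear_mult] Ck_on_open_det
      Ck_on_open_inverse assms(1) entries det_nz)
    show "Ck_on_open k W (\<lambda>p. ?N p m $ i $ j)" for m i j
      by (cases "j = m") (auto simp: entries Ck_on_open_const assms(1))
  qed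
  have eq: "?x p = inv (D p) v" if p: "p \<in> W" for p
  proof -
    have "matrix (D p) *v ?x p = v"
      using cramer[OF det_nz[OF p]] by (simp add: divide_inverse)
    then have "D p (?x p) = v"
      using assms(2)[OF p] by (simp add: matrix_works)
    then show ?thesis
      using bij_inv_eq_iff[OF assms(3)[OF p]] by simp
  qed
  show ?thesis
    by (rule Ck_on_open_cong[OF assms(1) eq smooth])
qed

text \<open>The derivative of the inverse \<open>h\<close> is \<open>v \<mapsto> (DG (h y))\<^sup>-\<^sup>1 v\<close>, a \<open>C\<^sup>k\<close>-map composed with \<open>h\<close>; so
  \<open>h\<close> gains one degree of smoothness at each step until that of \<open>G\<close> is reached. The neighbourhoods come from the
  \<open>C\<^sup>1\<close> theorem and do not depend on \<open>k\<close>, which is what makes the case \<open>r = \<infinity>\<close> work.\<close>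

theorem Ck_inverse_function_theorem:
  fixes G :: "real ^ 'n \<Rightarrow> real ^ 'n"
  assumes W: "open W" "p \<in> W" and C1: "Ck_on_open 1 W G" and inj: "inj (frechet_derivative G (at p))"
  obtains U V h where "open U" "U \<subseteq> W" "p \<in> U" "open V" "homeomorphism U V G h"
    "\<And>k. Ck_on_open k W G \<Longrightarrow> Ck_on_open k V h"
proof -
  let ?D = "\<lambda>p. frechet_derivative G (at p)"
  have C1': "Ck_on_open (Suc 0) W G" using C1 by simp
  have der: "(G has_derivative ?D q) (at q)" if "q \<in> W" for q
    using Ck_on_open_Suc_deriv[OF C1' that] .
  define F where "F q = Blinfun (?D q)" for q
  have F: "blinfun_apply (F q) = ?D q" if "q \<in> W" for q
    using der[OF that] unfolding F_def
    by (metis bounded_linear_Blinfun_apply has_derivative_bounded_linear)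
  have contF: "continuous_on W F"
  proof (rule continuous_on_blinfun_componentwise)
    fix i :: "real ^ 'n"
    have "continuous_on W (\<lambda>q. ?D q i)"
      using C1' by simp
    then show "continuous_on W (\<lambda>q. blinfun_apply (F q) i)"
      by (simp add: F cong: continuous_on_cong)
  qed
  have lin: "linear (?D p)"
    using der[OF W(2)] has_derivative_linear by blast
  obtain L where L: "linear L" "L \<circ> ?D p = id"
    using linear_injective_left_inverse[OF lin inj] by blast
  have invF: "Blinfun L o\<^sub>L F p = id_blinfun"
    using L F[OF W(2)] linear_conv_bounded_linear[of L]
    by (intro blinfun_eqI) (simp add: bounded_linear_Blinfun_apply pointfree_idE)
  obtain U V h h' where *: "open U" "U \<subseteq> W" "p \<in> U" "open V" "homeomorphism U V G h"
    and h': "\<And>y. y \<in> V \<Longrightarrow> (h has_derivative (h' y)) (at y)"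
      "\<And>y. y \<in> V \<Longrightarrow> h' y = inv (blinfun_apply (F (h y)))"
      "\<And>y. y \<in> V \<Longrightarrow> bij (blinfun_apply (F (h y)))"
    using inverse_function_theorem[OF W(1) _ contF W(2) invF] der F by metis
  have hV: "h ` V = U" "\<And>x. x \<in> V \<Longrightarrow> h x \<in> U"
    using *(5) by (auto simp: homeomorphism_def)
  have smooth: "Ck_on_open k V h" if "Ck_on_open k W G" for k
    using that
  proof (induction k)
    case 0
    then show ?case using * by (simp add: homeomorphism_def)
  next
    case (Suc k)
    have IH: "Ck_on_open k V h" using Suc Ck_on_open_SucD by blast
    have bij: "bij (?D q)" if "q \<in> U" for q
      using h'(3)[of "G q"] that *(2,5) F[of q] by (force simp: homeomorphism_def)
    have DU: "Ck_on_open k U (\<lambda>q. inv (?D q) v)" for v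
    proof (rule Ck_on_open_inverse_linear[OF *(1) _ bij])
      show "linear (?D q)" if "q \<in> U" for q
        using der[of q] that * has_derivative_linear by blast
      show "Ck_on_open k U (\<lambda>q. ?D q v)" for v
        using Suc.prems *(2) by (auto intro: Ck_on_open_subset)
    qed
    show ?case
    proof (rule Ck_on_open_SucI[where D="\<lambda>y. inv (?D (h y))"])
      show "(h has_derivative inv (?D (h y))) (at y)" if "y \<in> V" for y
        using h'(1,2)[OF that] F[of "h y"] hV(2)[OF that] *(2) by auto
      show "Ck_on_open k V (\<lambda>y. inv (?D (h y)) v)" for v
        using Ck_on_open_compose[OF *(4,1) IH _ DU] hV by simp
    qed (rule *)
  qed
  show ?thesis
    using that[OF *] smooth by blast
qed

section \<open>Geometry of the model spaces\<close>

lemma interior_half_space: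
  "interior (half_space :: (real ^ 'n::{finite,linorder}) set) = {x. 0 < x $ Min UNIV}"
  using interior_halfspace_component_ge[of 0 "Min (UNIV :: 'n set)"]
  by (simp add: half_space_def)

lemma model_space_closed_convex:
  assumes "S = UNIV \<or> S = (half_space :: (real ^ 'n::{finite,linorder}) set)"
  shows "closed S" "convex S" "closure (interior S) = S"
proof -
  show "closed S"
    using assms closed_halfspace_component_ge_cart[of 0 "Min (UNIV :: 'n set)"]
    by (auto simp: half_space_def)
  show "convex S"
    using assms convex_halfspace_ge[of 0 "axis (Min (UNIV :: 'n set)) (1::real)"]
    by (auto simp: half_space_def inner_axis' )
  have "(\<chi> i. 1) \<in> interior S"
    using assms by (auto simp: interior_half_space)
  then show "closure (interior S) = S"
    using convex_closure_interior[OF \<open>convex S\<close>] \<open>closed S\<close> by (auto simp: closure_closed)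
qed

text \<open>From any point of a relatively open subset of the half-space one can move a little in every positive
  coordinate direction without leaving the subset. Thus one-sided partial derivatives already determine the
  derivative.\<close>

lemma has_derivative_within_model_unique:
  fixes S \<Omega> :: "(real ^ 'n::{finite,linorder}) set"
  assumes S: "S = UNIV \<or> S = half_space"
    and \<Omega>: "openin (top_of_set S) \<Omega>" "p \<in> \<Omega>"
    and "(f has_derivative D) (at p within \<Omega>)" "(f has_derivative E) (at p within \<Omega>)"
  shows "D = E"
proof (rule frechet_derivative_unique_within[OF assms(4,5)])
  fix i :: "(real, 'n) vec" and e :: real
  assume "i \<in> Basis" "e > 0"
  then obtain m where i: "i = axis m 1"
    by (auto simp: Basis_vec_def)
  obtain O' where O': "open O'" "\<Omega> = S \<inter> O'"
    using \<Omega> by (metis openin_open)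
  then obtain d where d: "d > 0" "ball p d \<subseteq> O'"
    using \<Omega> open_contains_ball_eq by blast
  define t where "t = min (d/2) (e/2)"
  have t: "0 < t" "t < e" "t < d"
    using d \<open>e > 0\<close> by (auto simp: t_def)
  have "p + t *\<^sub>R i \<in> S"
    using S \<Omega> O' t by (auto simp: half_space_def i axis_def)
  moreover have "p + t *\<^sub>R i \<in> ball p d"
    using t \<open>i \<in> Basis\<close> by (simp add: dist_norm)
  ultimately show "\<exists>t. 0 < \<bar>t\<bar> \<and> \<bar>t\<bar> < e \<and> p + t *\<^sub>R i \<in> \<Omega>"
    using t d O' by (intro exI[of _ t]) auto
qed

text \<open>Let \<open>N\<close> be the intersection of a small ball around \<open>G p\<close> with the interior of \<open>T\<close>. It is convex, and no point
  of it is the image of a frontier point of \<open>S\<close>. Hence the images of the interior and of the complement of \<open>S\<close>,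
  which are disjoint open sets, cover \<open>N\<close>. The first one meets \<open>N\<close> because \<open>p\<close> is a limit of interior points of \<open>S\<close>,
  so it contains \<open>N\<close>, and the boundary points of \<open>T\<close> in the ball follow by passing to the closure.\<close>

lemma homeomorphism_image_neighbourhood:
  fixes G :: "'a::euclidean_space \<Rightarrow> 'a"
  assumes S: "closure (interior S) = S"
    and T: "convex T" "closure (interior T) = T"
    and hom: "open U" "open V" "homeomorphism U V G h"
    and p: "p \<in> S \<inter> U"
    and GT: "G ` (S \<inter> U) \<subseteq> T" and front: "G ` (frontier S \<inter> U) \<subseteq> frontier T"
  obtains B where "open B" "G p \<in> B" "T \<inter> B \<subseteq> G ` (S \<inter> U)"
proof -
  have G: "continuous_on U G" "continuous_on V h" "inj_on G U" "G ` U = V"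
    and GH: "\<And>y. y \<in> V \<Longrightarrow> G (h y) = y" "\<And>y. y \<in> V \<Longrightarrow> h y \<in> U"
    using homeomorphism_cont1[OF hom(3)] homeomorphism_cont2[OF hom(3)] homeomorphism_image1[OF hom(3)]
      homeomorphism_image2[OF hom(3)] homeomorphism_apply1[OF hom(3)] homeomorphism_apply2[OF hom(3)]
    by (auto intro: inj_on_inverseI[where g=h])
  have open_image: "open (G ` A)" if "open A" "A \<subseteq> U" for A
    using invariance_of_domain G that by (metis continuous_on_subset inj_on_subset)
  have "closed S" by (metis S closed_closure)
  \<comment> \<open>A closed ball inside \<open>V\<close>, so that \<open>h\<close> is still defined and continuous on the closure of \<open>N\<close>.\<close>
  obtain e where e: "e > 0" "cball (G p) e \<subseteq> V"
    using hom(2) G(4) p open_contains_cball_eq by blast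
  define N where "N = ball (G p) e \<inter> interior T"
  let ?A = "G ` (U \<inter> interior S)" and ?B = "G ` (U - S)"
  have "connected N"
    unfolding N_def using T by (intro convex_connected convex_Int convex_interior) auto
  have AT: "?A \<subseteq> interior T"
    using GT interior_subset[of S] hom(1) by (intro interior_maximal open_image) auto
  have "N \<subseteq> ?A \<union> ?B"
  proof
    fix y assume y: "y \<in> N"
    then have "y \<in> V" using e by (auto simp: N_def)
    then have hy: "h y \<in> U" "G (h y) = y" using GH by auto
    have "h y \<notin> frontier S"
    proof
      assume "h y \<in> frontier S"
      then have "y \<in> frontier T" using imageI[of "h y" "frontier S \<inter> U" G] front hy by auto
      then show False using y by (simp add: N_def frontier_def)
    qed
    then have "h y \<in> U \<inter> interior S \<or> h y \<in> U - S"
      using \<open>closed S\<close> hy by (auto simp: frontier_def)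
    then show "y \<in> ?A \<union> ?B"
      using hy(2) by (metis UnI1 UnI2 imageI)
  qed
  moreover have "?A \<inter> ?B = {}"
    using G(3) interior_subset[of S] by (auto simp: inj_on_def)
  moreover have "open ?A" "open ?B"
    using hom \<open>closed S\<close> by (auto intro!: open_image)
  moreover have "?A \<inter> N \<noteq> {}"
  proof -
    have "open (U \<inter> G -` ball (G p) e)"
      using continuous_open_preimage[OF G(1) hom(1)] by simp
    moreover have "p \<in> closure (interior S)" "p \<in> U \<inter> G -` ball (G p) e"
      using p S e by auto
    ultimately have "interior S \<inter> (U \<inter> G -` ball (G p) e) \<noteq> {}"
      using open_Int_closure_eq_empty[of "U \<inter> G -` ball (G p) e" "interior S"] by blast
    then show ?thesis using AT by (auto simp: N_def)
  qed
  ultimately have "?B \<inter> N = {}"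
    using connectedD[OF \<open>connected N\<close>, of ?A ?B] by blast
  have "h z \<in> S" if z: "z \<in> N" for z
  proof (rule ccontr)
    assume "h z \<notin> S"
    moreover have "z \<in> V" using z e by (auto simp: N_def)
    ultimately have "G (h z) = z" "h z \<in> U - S" using GH[of z] by auto
    then have "z \<in> ?B" by (metis imageI)
    then show False using \<open>?B \<inter> N = {}\<close> z by auto
  qed
  then have hN: "h ` N \<subseteq> S" by blast
  have "closure N \<subseteq> V"
    using e closure_mono[of N "ball (G p) e"] by (auto simp: N_def)
  then have hcl: "h ` closure N \<subseteq> S"
    using image_closure_subset[OF continuous_on_subset[OF G(2)] \<open>closed S\<close> hN] by blast
  have "T \<inter> ball (G p) e \<subseteq> closure N"
    using open_Int_closure_subset[of "ball (G p) e" "interior T"] T by (auto simp: N_def)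
  moreover have "y \<in> G ` (S \<inter> U)" if "y \<in> closure N" for y
    using hcl GH[of y] \<open>closure N \<subseteq> V\<close> that by (intro image_eqI[of _ _ "h y"]) auto
  ultimately have "T \<inter> ball (G p) e \<subseteq> G ` (S \<inter> U)"
    by blast
  with that[of "ball (G p) e"] e show thesis by simp
qed

section \<open>Charts and the topological boundary\<close>

lemma is_chartE:
  assumes "is_chart X (U, \<phi> :: 'a \<Rightarrow> real ^ 'n::{finite,linorder})"
  obtains S where "S = UNIV \<or> S = half_space" "openin X U"
    "homeomorphic_map (subtopology X U) (top_of_set S) \<phi>"
  using assms that[of UNIV] that[of half_space] unfolding is_chart_def by auto

lemma chart_bij_betw:
  assumes "openin X U" "homeomorphic_map (subtopology X U) (top_of_set S) \<phi>"
  shows "bij_betw \<phi> U S"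
proof -
  have "topspace (subtopology X U) = U"
    using assms(1) openin_subset by fastforce
  then show ?thesis
    using homeomorphic_imp_injective_map[OF assms(2)] homeomorphic_imp_surjective_map[OF assms(2)]
    by (simp add: bij_betw_def)
qed

lemma chart_openin_image:
  assumes "openin X U" "homeomorphic_map (subtopology X U) (top_of_set S) \<phi>" "openin X N" "N \<subseteq> U"
  shows "openin (top_of_set S) (\<phi> ` N)"
  using homeomorphic_imp_open_map[OF assms(2)] assms(1,3,4)
  by (simp add: open_map_def openin_open_subtopology)

lemma chart_openin_preimage:
  assumes "openin X U" "homeomorphic_map (subtopology X U) (top_of_set S) \<phi>" "open B"
  shows "openin X {x \<in> U. \<phi> x \<in> B}"
proof -
  have cm: "continuous_map (subtopology X U) (top_of_set S) \<phi>"
    using assms(2) homeomorphic_imp_continuous_map by blast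
  have top: "topspace (subtopology X U) = U"
    using assms(1) openin_subset by fastforce
  have "openin (subtopology X U) {x \<in> U. \<phi> x \<in> S \<inter> B}"
    using openin_continuous_map_preimage[OF cm, of "S \<inter> B"] assms(3) by (simp only: top) auto
  moreover have "{x \<in> U. \<phi> x \<in> S \<inter> B} = {x \<in> U. \<phi> x \<in> B}"
    using chart_bij_betw[OF assms(1,2)] by (auto simp: bij_betw_def)
  ultimately show ?thesis
    using assms(1) by (simp add: openin_open_subtopology)
qed

lemma homeomorphic_imp_homeomorphic_space:
  assumes "S homeomorphic T"
  shows "top_of_set S homeomorphic_space top_of_set T"
proof -
  obtain f g where fg: "homeomorphism S T f g"
    using assms by (auto simp: homeomorphic_def)
  have "homeomorphic_maps (top_of_set S) (top_of_set T) f g"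
    using homeomorphism_cont1[OF fg] homeomorphism_cont2[OF fg] homeomorphism_image1[OF fg]
      homeomorphism_image2[OF fg] homeomorphism_apply1[OF fg] homeomorphism_apply2[OF fg]
    by (auto simp: homeomorphic_maps_def continuous_map_in_subtopology)
  then show ?thesis
    by (auto simp: homeomorphic_space_def)
qed

text \<open>A point that a chart sends to the frontier of \<open>S\<close> has no neighbourhood homeomorphic to \<open>\<real>\<^sup>n\<close>:
  composing with the chart would give an injective continuous map from an open set of \<open>\<real>\<^sup>n\<close> whose image,
  open by invariance of domain, lies in \<open>S\<close> and contains a frontier point of \<open>S\<close>. In the other direction, a ball
  in the interior of \<open>S\<close> pulls back to a Euclidean neighbourhood.\<close>

lemma manifold_boundary_iff_frontier:
  fixes \<phi> :: "'a \<Rightarrow> real ^ 'n::{finite,linorder}"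
  assumes S: "closed S" and U: "openin X U" and hom: "homeomorphic_map (subtopology X U) (top_of_set S) \<phi>"
    and x: "x \<in> U"
  shows "x \<in> manifold_boundary TYPE('n) X \<longleftrightarrow> \<phi> x \<in> frontier S"
proof -
  note bij = chart_bij_betw[OF U hom]
  have \<phi>x: "\<phi> x \<in> S" using bij x by (auto simp: bij_betw_def)
  have xX: "x \<in> topspace X" using U x openin_subset by blast
  show ?thesis
  proof
    assume front: "\<phi> x \<in> frontier S"
    show "x \<in> manifold_boundary TYPE('n) X"
    proof (rule ccontr)
      assume "x \<notin> manifold_boundary TYPE('n) X"
      then obtain V where V: "openin X V" "x \<in> V"
        and hV: "subtopology X V homeomorphic_space (euclidean :: (real, 'n) vec topology)"
        using xX by (auto simp: manifold_boundary_def)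
      have topV: "topspace (subtopology X V) = V"
        using V(1) openin_subset by fastforce
      obtain \<theta> \<theta>' where maps: "homeomorphic_maps (subtopology X V) (euclidean :: (real, 'n) vec topology) \<theta> \<theta>'"
        using hV by (auto simp: homeomorphic_space_def)
      with topV have c': "continuous_map euclidean (subtopology X V) \<theta>'"
        and inv: "\<And>v. v \<in> V \<Longrightarrow> \<theta>' (\<theta> v) = v"
        by (auto simp: homeomorphic_maps_def)
      have \<theta>: "homeomorphic_map (subtopology X V) (top_of_set UNIV) \<theta>"
        using maps homeomorphic_map_maps by auto
      define W where "W = U \<inter> V"
      have W: "openin X W" "W \<subseteq> V" "W \<subseteq> U" "x \<in> W" using U V x by (auto simp: W_def)
      have op: "open (\<theta> ` W)"
        using chart_openin_image[OF V(1) \<theta> W(1,2)] by simp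
      have im: "\<theta>' ` \<theta> ` W = W" using inv W(2) by force
      have "continuous_map (top_of_set (\<theta> ` W)) (subtopology X U) \<theta>'"
        using c' im W by (auto simp: continuous_map_in_subtopology intro: continuous_map_from_subtopology)
      then have "continuous_map (top_of_set (\<theta> ` W)) (top_of_set S) (\<phi> \<circ> \<theta>')"
        using homeomorphic_imp_continuous_map[OF hom] continuous_map_compose by blast
      then have "continuous_on (\<theta> ` W) (\<phi> \<circ> \<theta>')"
        by (simp add: continuous_map_in_subtopology)
      moreover have "inj_on (\<phi> \<circ> \<theta>') (\<theta> ` W)"
      proof -
        have "inj_on \<phi> W" using bij W(3) by (meson bij_betw_def inj_on_subset)
        moreover have "\<theta>' (\<theta> w) = w" if "w \<in> W" for w using inv W(2) that by blast
        ultimately show ?thesis by (auto simp: inj_on_def)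
      qed
      ultimately have "open ((\<phi> \<circ> \<theta>') ` \<theta> ` W)"
        using invariance_of_domain op by blast
      then have "open (\<phi> ` W)" by (simp only: image_comp[symmetric] im)
      moreover have "\<phi> ` W \<subseteq> S" using bij W by (auto simp: bij_betw_def)
      ultimately have "\<phi> x \<in> interior S" using W by (metis imageI interior_maximal subsetD)
      then show False using front by (simp add: frontier_def)
    qed
  next
    assume bd: "x \<in> manifold_boundary TYPE('n) X"
    show "\<phi> x \<in> frontier S"
    proof (rule ccontr)
      assume "\<phi> x \<notin> frontier S"
      then have "\<phi> x \<in> interior S"
        using \<phi>x S by (simp add: frontier_def)
      then obtain e where e: "e > 0" "ball (\<phi> x) e \<subseteq> S"
        by (meson mem_interior)
      define V where "V = {u \<in> U. \<phi> u \<in> ball (\<phi> x) e}"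
      have V: "openin X V" "x \<in> V" "V \<subseteq> U"
        using chart_openin_preimage[OF U hom, of "ball (\<phi> x) e"] x e by (auto simp: V_def)
      have "topspace (subtopology X U) = U"
        using U openin_subset by fastforce
      moreover have "\<phi> ` V = ball (\<phi> x) e"
      proof -
        have "ball (\<phi> x) e \<subseteq> \<phi> ` U" using bij e by (simp add: bij_betw_def)
        then show ?thesis unfolding V_def by blast
      qed
      ultimately have "homeomorphic_map (subtopology (subtopology X U) V)
          (subtopology (top_of_set S) (ball (\<phi> x) e)) \<phi>"
        using V e by (intro homeomorphic_map_subtopologies[OF hom]) (simp add: Int_absorb1)
      then have "subtopology X V homeomorphic_space top_of_set (ball (\<phi> x) e)"
        using V e homeomorphic_map_imp_homeomorphic_space
        by (fastforce simp: subtopology_subtopology Int_absorb1)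
      moreover have "ball (\<phi> x) e homeomorphic (UNIV :: (real, 'n) vec set)"
        using e homeomorphic_balls(1)[of e 1 "\<phi> x" 0] homeomorphic_ball01_UNIV homeomorphic_trans by force
      then have "top_of_set (ball (\<phi> x) e) homeomorphic_space (euclidean :: (real, 'n) vec topology)"
        using homeomorphic_imp_homeomorphic_space by fastforce
      ultimately have "subtopology X V homeomorphic_space (euclidean :: (real, 'n) vec topology)"
        using homeomorphic_space_trans by blast
      then show False using bd V by (auto simp: manifold_boundary_def)
    qed
  qed
qed

section \<open>Nondegenerate maps in charts\<close>

lemma Cr_manifold_charts:
  assumes "Cr_manifold r X (\<A> :: ('a, 'n::{finite,linorder}) chart set set)"
  shows "c \<in> \<Union>\<A> \<Longrightarrow> is_chart X c"
    and "x \<in> topspace X \<Longrightarrow> \<exists>c\<in>\<Union>\<A>. x \<in> fst c"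
    and "Hausdorff_space X"
proof -
  obtain A where A: "Cr_structure r X A" "\<A> = Cr_structure_equiv r X `` {A}"
    using assms unfolding Cr_manifold_def quotient_def by blast
  show "is_chart X c" if "c \<in> \<Union>\<A>"
    using that unfolding A(2) by (auto simp: Cr_structure_equiv_def Cr_structure_def)
  have "A \<in> \<A>"
    using A by (simp add: Cr_structure_equiv_def)
  moreover have "\<Union>(fst ` A) = topspace X"
    using A(1) by (simp add: Cr_structure_def)
  ultimately show "\<exists>c\<in>\<Union>\<A>. x \<in> fst c" if "x \<in> topspace X"
    using that by blast
  show "Hausdorff_space X"
    using assms by (simp add: Cr_manifold_def topological_manifold_def)
qed

lemma local_rep_apply:
  assumes "bij_betw \<phi> U S" "u \<in> U"
  shows "local_rep f (U, \<phi>) (V, \<psi>) (\<phi> u) = \<psi> (f u)"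
  using assms by (simp add: local_rep_def bij_betw_def)

text \<open>Both the openness of \<open>f\<close> and the smoothness of its inverse rest on this local description. The set \<open>N\<close> is
  there to make \<open>U'\<close> as small as needed.\<close>

lemma local_rep_smooth_inverse:
  fixes \<phi> :: "'a \<Rightarrow> real ^ 'n::{finite,linorder}" and \<psi> :: "'b \<Rightarrow> (real, 'n) vec"
  assumes r: "1 \<le> r" and S: "S = UNIV \<or> S = half_space"
    and U: "openin X U" "homeomorphic_map (subtopology X U) (top_of_set S) \<phi>"
    and V: "openin Y V"
    and f: "continuous_map X Y f" "Cr_on r (local_dom f (U, \<phi>) (V, \<psi>)) (local_rep f (U, \<phi>) (V, \<psi>))"
    and x: "x \<in> U" "f x \<in> V"
    and rank: "differential_rank_in_charts f (U, \<phi>) (V, \<psi>) x = CARD('n)"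
    and N: "openin X N" "x \<in> N"
  obtains U' V' G h where "open U'" "open V'" "\<phi> x \<in> U'" "homeomorphism U' V' G h"
    "S \<inter> U' \<subseteq> \<phi> ` {u \<in> U \<inter> N. f u \<in> V}"
    "\<forall>u\<in>U. \<phi> u \<in> U' \<longrightarrow> f u \<in> V \<and> G (\<phi> u) = \<psi> (f u)"
    "\<forall>k. enat k \<le> r \<longrightarrow> Ck_on_open k V' h"
proof -
  let ?\<Omega> = "local_dom f (U, \<phi>) (V, \<psi>)" and ?g = "local_rep f (U, \<phi>) (V, \<psi>)"
  note bij = chart_bij_betw[OF U]
  let ?M = "{u \<in> U \<inter> N. f u \<in> V}"
  have UX: "U \<subseteq> topspace X" using U(1) openin_subset by blast
  have pre: "openin X {u \<in> topspace X. f u \<in> V}"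
    using openin_continuous_map_preimage[OF f(1) V] .
  have "openin X ({u \<in> topspace X. f u \<in> V} \<inter> (U \<inter> N))" "openin X ({u \<in> topspace X. f u \<in> V} \<inter> U)"
    using pre U(1) N by (auto intro: openin_Int)
  moreover have "{u \<in> topspace X. f u \<in> V} \<inter> (U \<inter> N) = ?M" "{u \<in> topspace X. f u \<in> V} \<inter> U = U \<inter> f -` V"
    using UX by auto
  ultimately have M: "openin X ?M" and "openin X (U \<inter> f -` V)" by simp_all
  then have \<Omega>: "openin (top_of_set S) ?\<Omega>"
    using chart_openin_image[OF U] by (simp add: local_dom_def)
  have "openin (top_of_set S) (\<phi> ` ?M)"
    using chart_openin_image[OF U M] by blast
  then obtain O' where O': "open O'" "\<phi> ` ?M = S \<inter> O'"
    unfolding openin_open by blast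
  have x\<Omega>: "\<phi> x \<in> ?\<Omega>" using x by (auto simp: local_dom_def)
  obtain W G where "open W \<and> \<phi> x \<in> W \<and> (\<forall>q\<in>?\<Omega> \<inter> W. G q = ?g q) \<and> (\<forall>k. enat k \<le> r \<longrightarrow> Ck_on_open k W G)"
    using bspec[OF f(2)[unfolded Cr_on_def] x\<Omega>] by (elim exE)
  then have WG: "open W" "\<phi> x \<in> W" "\<And>q. q \<in> ?\<Omega> \<inter> W \<Longrightarrow> G q = ?g q"
    and smooth: "\<And>k. enat k \<le> r \<Longrightarrow> Ck_on_open k W G"
    by simp_all
  have C1: "Ck_on_open (Suc 0) W G"
    using smooth[of "Suc 0"] r by (simp add: one_enat_def)
  let ?D = "frechet_derivative G (at (\<phi> x))"
  have G': "(G has_derivative ?D) (at (\<phi> x))"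
    using Ck_on_open_Suc_deriv[OF C1 WG(2)] .
  obtain d where d: "d > 0" "ball (\<phi> x) d \<subseteq> W"
    using WG(1,2) open_contains_ball_eq by blast
  \<comment> \<open>The rank hypothesis concerns the derivative within \<open>?\<Omega>\<close>; it is that of \<open>G\<close> by uniqueness.\<close>
  have g': "(?g has_derivative ?D) (at (\<phi> x) within ?\<Omega>)"
  proof (rule has_derivative_transform_within[OF has_derivative_at_withinI[OF G'] d(1) x\<Omega>])
    fix q assume "q \<in> ?\<Omega>" "dist q (\<phi> x) < d"
    then show "G q = ?g q"
      using d WG(3)[of q] by (auto simp: dist_commute subset_iff)
  qed
  then have "(?g has_derivative frechet_derivative ?g (at (\<phi> x) within ?\<Omega>)) (at (\<phi> x) within ?\<Omega>)"
    using differentiableI frechet_derivative_works by blast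
  then have "frechet_derivative ?g (at (\<phi> x) within ?\<Omega>) = ?D"
    using has_derivative_within_model_unique[OF S \<Omega> x\<Omega> _ g'] by blast
  then have "rank (matrix ?D) = CARD('n)"
    using rank by (simp add: differential_rank_in_charts_def)
  then have "inj ((*v) (matrix ?D))"
    by (simp add: full_rank_injective)
  moreover have "(*v) (matrix ?D) = ?D"
    using has_derivative_linear[OF G'] by (auto simp: matrix_works)
  ultimately have inj: "inj ?D" by simp
  define W0 where "W0 = W \<inter> O'"
  have W0: "open W0" "\<phi> x \<in> W0" "W0 \<subseteq> W"
    using WG O' x N by (auto simp: W0_def)
  have "Ck_on_open 1 W0 G"
    using Ck_on_open_subset[OF C1 W0(3)] by simp
  from Ck_inverse_function_theorem[OF W0(1,2) this inj]
  obtain U' V' h where UV: "open U'" "U' \<subseteq> W0" "\<phi> x \<in> U'" "open V'" "homeomorphism U' V' G h"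
    and h: "\<And>k. Ck_on_open k W0 G \<Longrightarrow> Ck_on_open k V' h"
    by metis
  show thesis
  proof (rule that[OF UV(1,4,3,5)])
    show sub: "S \<inter> U' \<subseteq> \<phi> ` ?M"
      using UV(2) O' by (auto simp: W0_def)
    show "\<forall>u\<in>U. \<phi> u \<in> U' \<longrightarrow> f u \<in> V \<and> G (\<phi> u) = \<psi> (f u)"
    proof (intro ballI impI)
      fix u assume u: "u \<in> U" "\<phi> u \<in> U'"
      have "\<phi> u \<in> S" using bij u by (auto simp: bij_betw_def)
      then obtain u' where u': "u' \<in> U" "f u' \<in> V" "\<phi> u = \<phi> u'" using sub u by blast
      then have "u' = u" using bij u by (auto simp: bij_betw_def inj_on_def)
      with u' have fu: "f u \<in> V" by simp
      then have "G (\<phi> u) = ?g (\<phi> u)"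
        using u UV(2) by (intro WG(3)) (auto simp: local_dom_def W0_def)
      then show "f u \<in> V \<and> G (\<phi> u) = \<psi> (f u)"
        using local_rep_apply[OF bij u(1), of f V \<psi>] fu by simp
    qed
    show "\<forall>k. enat k \<le> r \<longrightarrow> Ck_on_open k V' h"
      using h Ck_on_open_subset[OF smooth W0(3)] by blast
  qed
qed

text \<open>The condition on boundaries is exactly what \<open>homeomorphism_image_neighbourhood\<close> asks of the
  extension \<open>G\<close> of a local representation, and this yields openness. Injectivity is inherited from \<open>G\<close>.\<close>

lemma nondegenerate_locally_open_injective:
  fixes \<A> :: "('a, 'n::{finite,linorder}) chart set set" and \<B> :: "('b, 'n) chart set set"
  assumes r: "1 \<le> r" and X: "Cr_manifold r X \<A>" and Y: "Cr_manifold r Y \<B>"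
    and f: "Cr_mapping r X \<A> Y \<B> f" "nondegenerate_differential X \<A> \<B> f"
    and bd: "f ` manifold_boundary TYPE('n) X \<subseteq> manifold_boundary TYPE('n) Y"
    and N: "openin X N" "x \<in> N"
  shows "\<exists>M. openin Y M \<and> f x \<in> M \<and> M \<subseteq> f ` N" and "\<exists>N'. openin X N' \<and> x \<in> N' \<and> inj_on f N'"
proof -
  have xX: "x \<in> topspace X" using N openin_subset by blast
  have cont: "continuous_map X Y f" using f(1) by (simp add: Cr_mapping_def)
  have "f x \<in> topspace Y" using cont xX by (auto simp: continuous_map_def)
  then obtain U \<phi> V \<psi> where c: "(U, \<phi>) \<in> \<Union>\<A>" "x \<in> U" and d: "(V, \<psi>) \<in> \<Union>\<B>" "f x \<in> V"
    using Cr_manifold_charts(2)[OF X xX] Cr_manifold_charts(2)[OF Y] by (metis prod.collapse)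
  obtain S where S: "S = UNIV \<or> S = half_space" and U: "openin X U"
      "homeomorphic_map (subtopology X U) (top_of_set S) \<phi>"
    using is_chartE Cr_manifold_charts(1)[OF X c(1)] by metis
  obtain T where T: "T = UNIV \<or> T = half_space" and V: "openin Y V"
      "homeomorphic_map (subtopology Y V) (top_of_set T) \<psi>"
    using is_chartE Cr_manifold_charts(1)[OF Y d(1)] by metis
  have Cr: "Cr_on r (local_dom f (U, \<phi>) (V, \<psi>)) (local_rep f (U, \<phi>) (V, \<psi>))"
    using f(1) c(1) d(1) unfolding Cr_mapping_def by blast
  have rank: "differential_rank_in_charts f (U, \<phi>) (V, \<psi>) x = CARD('n)"
    using f(2) c d xX unfolding nondegenerate_differential_def by fastforce
  obtain U' V' G h where UV: "open U'" "open V'" "\<phi> x \<in> U'" "homeomorphism U' V' G h"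
    and sub: "S \<inter> U' \<subseteq> \<phi> ` {u \<in> U \<inter> N. f u \<in> V}"
    and G: "\<forall>u\<in>U. \<phi> u \<in> U' \<longrightarrow> f u \<in> V \<and> G (\<phi> u) = \<psi> (f u)"
    and "\<forall>k. enat k \<le> r \<longrightarrow> Ck_on_open k V' h"
    by (rule local_rep_smooth_inverse[OF r S U V(1) cont Cr c(2) d(2) rank N]) (rule that)
  note S_bij = chart_bij_betw[OF U] and T_bij = chart_bij_betw[OF V]
  note S' = model_space_closed_convex[OF S] and T' = model_space_closed_convex[OF T]
  have GT: "G ` (S \<inter> U') \<subseteq> T"
    using sub G T_bij by (fastforce simp: bij_betw_def)
  have front: "G ` (frontier S \<inter> U') \<subseteq> frontier T"
  proof clarify
    fix q assume q: "q \<in> frontier S" "q \<in> U'"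
    then have "q \<in> S" using S'(1) by (meson frontier_subset_closed subsetD)
    then obtain u where u: "u \<in> U" "f u \<in> V" "q = \<phi> u" using sub q by blast
    then have "u \<in> manifold_boundary TYPE('n) X"
      using manifold_boundary_iff_frontier[OF S'(1) U u(1)] q by simp
    then have "f u \<in> manifold_boundary TYPE('n) Y" using bd by blast
    then have "\<psi> (f u) \<in> frontier T"
      using manifold_boundary_iff_frontier[OF T'(1) V u(2)] by simp
    then show "G q \<in> frontier T" using G u q by simp
  qed
  have "\<phi> x \<in> S \<inter> U'" using S_bij c(2) UV(3) by (auto simp: bij_betw_def)
  then obtain B where B: "open B" "G (\<phi> x) \<in> B" "T \<inter> B \<subseteq> G ` (S \<inter> U')"
    by (rule homeomorphism_image_neighbourhood[OF S'(3) T'(2,3) UV(1,2,4) _ GT front])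
  have "openin Y {y \<in> V. \<psi> y \<in> B}"
    using chart_openin_preimage[OF V B(1)] .
  moreover have "f x \<in> {y \<in> V. \<psi> y \<in> B}"
    using G c(2) UV(3) B(2) d(2) by simp
  moreover have "{y \<in> V. \<psi> y \<in> B} \<subseteq> f ` N"
  proof clarify
    fix y assume y: "y \<in> V" "\<psi> y \<in> B"
    then have "\<psi> y \<in> T" using T_bij by (auto simp: bij_betw_def)
    then obtain q where q: "q \<in> S" "q \<in> U'" "\<psi> y = G q" using B(3) y by blast
    then obtain u where u: "u \<in> U" "u \<in> N" "f u \<in> V" "q = \<phi> u" using sub by blast
    then have "\<psi> y = \<psi> (f u)" using G u q by simp
    then have "y = f u" using T_bij y u by (auto simp: bij_betw_def inj_on_def)
    then show "y \<in> f ` N" using u by blast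
  qed
  ultimately show "\<exists>M. openin Y M \<and> f x \<in> M \<and> M \<subseteq> f ` N" by blast
  have "inj_on f {u \<in> U. \<phi> u \<in> U'}"
  proof (rule inj_onI, clarify)
    fix u v assume uv: "u \<in> U" "\<phi> u \<in> U'" "v \<in> U" "\<phi> v \<in> U'" "f u = f v"
    then have "G (\<phi> u) = G (\<phi> v)" using G by simp
    then have "\<phi> u = \<phi> v" using uv UV(4) by (metis homeomorphism_apply1)
    then show "u = v" using uv S_bij by (auto simp: bij_betw_def inj_on_def)
  qed
  then show "\<exists>N'. openin X N' \<and> x \<in> N' \<and> inj_on f N'"
    using chart_openin_preimage[OF U UV(1)] c(2) UV(3) by blast
qed

text \<open>Near a point, the local inverse \<open>h\<close> of \<open>G\<close> extends the local representation of \<open>f\<^sup>-\<^sup>1\<close>. For this the values of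
  \<open>f\<^sup>-\<^sup>1\<close> must stay in the region where \<open>h\<close> inverts \<open>G\<close>, which its continuity guarantees.\<close>

lemma nondegenerate_inverse_Cr_mapping:
  fixes \<A> :: "('a, 'n::{finite,linorder}) chart set set" and \<B> :: "('b, 'n) chart set set"
  assumes r: "1 \<le> r" and X: "Cr_manifold r X \<A>" and Y: "Cr_manifold r Y \<B>"
    and f: "Cr_mapping r X \<A> Y \<B> f" "nondegenerate_differential X \<A> \<B> f"
    and hom: "open_map X Y f" "bij_betw f (topspace X) (topspace Y)"
  shows "Cr_mapping r Y \<B> X \<A> (inv_into (topspace X) f)"
proof -
  let ?g = "inv_into (topspace X) f"
  have cont: "continuous_map X Y f" using f(1) by (simp add: Cr_mapping_def)
  have g: "\<And>x. x \<in> topspace X \<Longrightarrow> ?g (f x) = x" "\<And>y. y \<in> topspace Y \<Longrightarrow> f (?g y) = y"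
    "\<And>y. y \<in> topspace Y \<Longrightarrow> ?g y \<in> topspace X"
    using hom(2) by (auto simp: bij_betw_inv_into_left bij_betw_inv_into_right bij_betw_def inv_into_into)
  have "homeomorphic_maps X Y f ?g"
  proof -
    have "homeomorphic_map X Y f"
      using bijective_open_imp_homeomorphic_map[OF cont hom(1)] hom(2) by (simp add: bij_betw_def)
    then obtain g' where g': "homeomorphic_maps X Y f g'" using homeomorphic_map_maps by blast
    have "continuous_map Y X ?g"
    proof (rule continuous_map_eq)
      show "continuous_map Y X g'" using g' by (simp add: homeomorphic_maps_def)
      show "g' y = ?g y" if "y \<in> topspace Y" for y
        using g' g(2,3) that unfolding homeomorphic_maps_def by metis
    qed
    then show ?thesis using cont g by (simp add: homeomorphic_maps_def)
  qed
  then have contg: "continuous_map Y X ?g" by (simp add: homeomorphic_maps_def)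
  have "Cr_on r (local_dom ?g (V, \<psi>) (U, \<phi>)) (local_rep ?g (V, \<psi>) (U, \<phi>))"
    if d: "(V, \<psi>) \<in> \<Union>\<B>" and c: "(U, \<phi>) \<in> \<Union>\<A>" for U V \<phi> \<psi>
    unfolding Cr_on_def
  proof
    fix q assume "q \<in> local_dom ?g (V, \<psi>) (U, \<phi>)"
    then obtain y where y: "y \<in> V" "?g y \<in> U" "q = \<psi> y" by (auto simp: local_dom_def)
    obtain S where S: "S = UNIV \<or> S = half_space" and U: "openin X U"
        "homeomorphic_map (subtopology X U) (top_of_set S) \<phi>"
      using is_chartE Cr_manifold_charts(1)[OF X c] by metis
    obtain T where T: "T = UNIV \<or> T = half_space" and V: "openin Y V"
        "homeomorphic_map (subtopology Y V) (top_of_set T) \<psi>"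
      using is_chartE Cr_manifold_charts(1)[OF Y d] by metis
    note S_bij = chart_bij_betw[OF U] and T_bij = chart_bij_betw[OF V]
    have VY: "V \<subseteq> topspace Y" using V(1) openin_subset by blast
    have Cr: "Cr_on r (local_dom f (U, \<phi>) (V, \<psi>)) (local_rep f (U, \<phi>) (V, \<psi>))"
      using f(1) c d unfolding Cr_mapping_def by blast
    have x: "?g y \<in> topspace X" "f (?g y) = y" using g y VY by auto
    have rank: "differential_rank_in_charts f (U, \<phi>) (V, \<psi>) (?g y) = CARD('n)"
      using f(2) c d x y unfolding nondegenerate_differential_def by fastforce
    have "f (?g y) \<in> V" using x y by simp
    note inverse = local_rep_smooth_inverse[OF r S U V(1) cont Cr y(2) this rank openin_topspace x(1)]
    obtain U' V' G h where UV: "open U'" "open V'" "\<phi> (?g y) \<in> U'" "homeomorphism U' V' G h"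
      and "S \<inter> U' \<subseteq> \<phi> ` {u \<in> U \<inter> topspace X. f u \<in> V}"
      and G: "\<forall>u\<in>U. \<phi> u \<in> U' \<longrightarrow> f u \<in> V \<and> G (\<phi> u) = \<psi> (f u)"
      and h: "\<forall>k. enat k \<le> r \<longrightarrow> Ck_on_open k V' h"
      by (rule inverse) (rule that)
    \<comment> \<open>On \<open>M\<close> the map \<open>f\<^sup>-\<^sup>1\<close> takes values where \<open>G\<close> is injective.\<close>
    define M where "M = {z \<in> V. ?g z \<in> {u \<in> U. \<phi> u \<in> U'}}"
    have "openin Y (V \<inter> {z \<in> topspace Y. ?g z \<in> {u \<in> U. \<phi> u \<in> U'}})"
      using openin_continuous_map_preimage[OF contg chart_openin_preimage[OF U UV(1)]] V(1)
      by (rule openin_Int[rotated])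
    moreover have "V \<inter> {z \<in> topspace Y. ?g z \<in> {u \<in> U. \<phi> u \<in> U'}} = M"
      using VY by (auto simp: M_def)
    ultimately have "openin (top_of_set T) (\<psi> ` M)"
      using chart_openin_image[OF V] by (auto simp: M_def)
    then obtain B where B: "open B" "\<psi> ` M = T \<inter> B" unfolding openin_open by blast
    have hG: "h (\<psi> z) = \<phi> (?g z)" and V'z: "\<psi> z \<in> V'" if z: "z \<in> M" for z
    proof -
      have gz: "?g z \<in> U" "\<phi> (?g z) \<in> U'" "f (?g z) = z" using z g VY by (auto simp: M_def)
      then have Gz: "G (\<phi> (?g z)) = \<psi> z" using G by simp
      show "h (\<psi> z) = \<phi> (?g z)" using Gz homeomorphism_apply1[OF UV(4) gz(2)] by simp
      show "\<psi> z \<in> V'" using Gz homeomorphism_image1[OF UV(4)] imageI[OF gz(2), of G] by simp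
    qed
    show "\<exists>W G. open W \<and> q \<in> W \<and>
        (\<forall>p\<in>local_dom ?g (V, \<psi>) (U, \<phi>) \<inter> W. G p = local_rep ?g (V, \<psi>) (U, \<phi>) p) \<and>
        (\<forall>k. enat k \<le> r \<longrightarrow> Ck_on_open k W G)"
    proof (intro exI[of _ "V' \<inter> B"] exI[of _ h] conjI ballI allI impI)
      show "open (V' \<inter> B)" using UV B by blast
      have "y \<in> M" using y UV(3) by (simp add: M_def)
      then show "q \<in> V' \<inter> B" using V'z B(2) y(3) by blast
      show "Ck_on_open k (V' \<inter> B) h" if "enat k \<le> r" for k
        using Ck_on_open_subset[of k V' h "V' \<inter> B"] h that by simp
      fix p assume p: "p \<in> local_dom ?g (V, \<psi>) (U, \<phi>) \<inter> (V' \<inter> B)"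
      then obtain z where z: "z \<in> V" "p = \<psi> z" by (auto simp: local_dom_def)
      then have "p \<in> T \<inter> B" using p T_bij by (auto simp: bij_betw_def)
      then obtain z' where z': "z' \<in> M" "p = \<psi> z'" using B(2) by blast
      then have "z' \<in> V" by (simp add: M_def)
      then show "h p = local_rep ?g (V, \<psi>) (U, \<phi>) p"
        using hG[OF z'(1)] z'(2) local_rep_apply[OF T_bij, of z' ?g U \<phi>] by simp
    qed
  qed
  then have "Cr_on r (local_dom ?g d c) (local_rep ?g d c)" if "d \<in> \<Union>\<B>" "c \<in> \<Union>\<A>" for c d
    using that by (metis prod.collapse)
  then show ?thesis
    using contg unfolding Cr_mapping_def by blast
qed

section \<open>From local to global\<close>

text \<open>The image of \<open>f\<close> is open and closed in \<open>Y\<close>, and so is the set of points with a one-point fibre; both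
  are nonempty, hence everything.\<close>

lemma locally_injective_unique_fibre_imp_bij:
  assumes X: "compact_space X" "Hausdorff_space X" and Y: "Hausdorff_space Y" "connected_space Y"
    and f: "continuous_map X Y f" "open_map X Y f"
    and loc_inj: "\<And>x. x \<in> topspace X \<Longrightarrow> \<exists>N. openin X N \<and> x \<in> N \<and> inj_on f N"
    and y0: "y0 \<in> topspace Y" "\<exists>!x. x \<in> topspace X \<and> f x = y0"
  shows "bij_betw f (topspace X) (topspace Y)"
proof -
  have closed_f: "closed_map X Y f"
    using continuous_imp_closed_map[OF f(1) X(1) Y(1)] .
  have clopen: "A = {} \<or> A = topspace Y" if "openin Y A" "closedin Y A" for A
    using Y(2) that by (auto simp: connected_space_clopen_in)
  have surj: "f ` topspace X = topspace Y"
  proof -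
    have "openin Y (f ` topspace X)" "closedin Y (f ` topspace X)"
      using f(2) closed_f by (auto simp: open_map_def closed_map_def)
    then show ?thesis using clopen y0(2) by auto
  qed
  define A where "A = {y \<in> topspace Y. \<exists>!x. x \<in> topspace X \<and> f x = y}"
  have "openin Y A"
  proof (subst openin_subopen, intro ballI)
    fix y assume "y \<in> A"
    then obtain x where x: "x \<in> topspace X" "f x = y" and y: "y \<in> topspace Y"
      and uniq: "\<And>x'. x' \<in> topspace X \<Longrightarrow> f x' = y \<Longrightarrow> x' = x"
      by (auto simp: A_def)
    obtain N where N: "openin X N" "x \<in> N" "inj_on f N" using loc_inj[OF x(1)] by blast
    \<comment> \<open>Points near \<open>y\<close> have their whole fibre in \<open>N\<close>, because the image of the complement of \<open>N\<close> is closed.\<close>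
    let ?M = "topspace Y - f ` (topspace X - N)"
    have "closedin X (topspace X - N)" using N by blast
    then have "openin Y ?M"
      using closed_f by (auto simp: closed_map_def)
    moreover have "y \<in> ?M" using y uniq N by auto
    moreover have "?M \<subseteq> A"
    proof
      fix z assume z: "z \<in> ?M"
      then have "z \<in> f ` topspace X" using surj by simp
      then obtain u where u: "u \<in> topspace X" "f u = z" by blast
      have "u' \<in> N" if "u' \<in> topspace X" "f u' = z" for u' using z that by blast
      then show "z \<in> A" using z u N(3) by (auto simp: A_def inj_on_def)
    qed
    ultimately show "\<exists>T. openin Y T \<and> y \<in> T \<and> T \<subseteq> A" by blast
  qed
  moreover have "openin Y (topspace Y - A)"
  proof (subst openin_subopen, intro ballI)
    fix y assume y: "y \<in> topspace Y - A"
    then have "y \<in> f ` topspace X" using surj by simp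
    then obtain x1 where x1: "x1 \<in> topspace X" "f x1 = y" by blast
    then obtain x2 where x2: "x2 \<in> topspace X" "f x2 = y" "x1 \<noteq> x2"
      using y by (auto simp: A_def)
    obtain N1 N2 where N: "openin X N1" "openin X N2" "x1 \<in> N1" "x2 \<in> N2" "disjnt N1 N2"
      using X(2) x1 x2 unfolding Hausdorff_space_def by metis
    \<comment> \<open>Every point of this intersection has two preimages.\<close>
    have "openin Y (f ` N1 \<inter> f ` N2)"
      using N f(2) by (auto simp: open_map_def)
    moreover have "y \<in> f ` N1 \<inter> f ` N2" using N x1 x2 by (metis IntI imageI)
    moreover have "f ` N1 \<inter> f ` N2 \<subseteq> topspace Y - A"
    proof
      fix z assume "z \<in> f ` N1 \<inter> f ` N2"
      then obtain a b where ab: "a \<in> N1" "b \<in> N2" "f a = z" "f b = z" by auto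
      then have "a \<noteq> b" "a \<in> topspace X" "b \<in> topspace X"
        using N openin_subset by (auto simp: disjnt_iff)
      then show "z \<in> topspace Y - A" using ab surj by (auto simp: A_def)
    qed
    ultimately show "\<exists>T. openin Y T \<and> y \<in> T \<and> T \<subseteq> topspace Y - A" by blast
  qed
  then have "closedin Y A" by (auto simp: closedin_def A_def)
  moreover have "y0 \<in> A" using y0 by (simp add: A_def)
  ultimately have A: "A = topspace Y" using clopen by blast
  have "inj_on f (topspace X)"
  proof (rule inj_onI)
    fix u v assume uv: "u \<in> topspace X" "v \<in> topspace X" "f u = f v"
    then have "f u \<in> A" using A surj by blast
    then have "\<exists>!x. x \<in> topspace X \<and> f x = f u" by (simp add: A_def)
    then show "u = v" using uv(1,2) uv(3)[symmetric] by blast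
  qed
  then show ?thesis using surj by (simp add: bij_betw_def)
qed

theorem theorem2p2:
  fixes r :: enat
    and X :: "'a topology" and \<A> :: "('a, 'n::{finite,linorder}) chart set set"
    and Y :: "'b topology" and \<B> :: "('b, 'n) chart set set"
    and f :: "'a \<Rightarrow> 'b"
  assumes "1 \<le> r"
    and "Cr_manifold r X \<A>" and "connected_space X" and "compact_space X"
    and "Cr_manifold r Y \<B>" and "connected_space Y"
    and "Cr_mapping r X \<A> Y \<B> f"
    and "nondegenerate_differential X \<A> \<B> f"
    and "f ` manifold_boundary TYPE('n) X \<subseteq> manifold_boundary TYPE('n) Y"
    and "\<exists>y\<in>topspace Y. \<exists>!x. x \<in> topspace X \<and> f x = y"
  shows "Cr_diffeomorphism r X \<A> Y \<B> f"
proof -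
  note local = nondegenerate_locally_open_injective[OF assms(1,2,5,7,8,9)]
  have cont: "continuous_map X Y f"
    using assms(7) by (simp add: Cr_mapping_def)
  have "open_map X Y f"
    unfolding open_map_def
  proof (intro allI impI)
    fix N assume N: "openin X N"
    show "openin Y (f ` N)"
    proof (subst openin_subopen, intro ballI)
      fix y assume "y \<in> f ` N"
      then show "\<exists>M. openin Y M \<and> y \<in> M \<and> M \<subseteq> f ` N"
        using local(1)[OF N] by blast
    qed
  qed
  obtain y where y: "y \<in> topspace Y" "\<exists>!x. x \<in> topspace X \<and> f x = y"
    using assms(10) by blast
  have bij: "bij_betw f (topspace X) (topspace Y)"
    using locally_injective_unique_fibre_imp_bij[OF assms(4) Cr_manifold_charts(3)[OF assms(2)]
        Cr_manifold_charts(3)[OF assms(5)] assms(6) cont \<open>open_map X Y f\<close> _ y]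
      local(2)[OF openin_topspace] by blast
  then show ?thesis
    using nondegenerate_inverse_Cr_mapping[OF assms(1,2,5,7,8) \<open>open_map X Y f\<close> bij] assms(7)
    by (simp add: Cr_diffeomorphism_def)
qed

end
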